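(* Let $G=\langle \mathcal X\mid\mathcal Q\mid\Phi\mid\mathcal R\rangle$ be a group given by an invariant finite $L$-presentation and let $\mathcal U\le G$ be a subgroup of finite index which is leaf-invariant. Then $\mathcal U$ is invariantly finitely $L$-presented.
   Context: A finite $L$-presentation $\langle \mathcal X\mid\mathcal Q\mid\Phi\mid\mathcal R\rangle$ consists of a finite alphabet $\mathcal X$, finite subsets $\mathcal Q,\mathcal R$ of the free group $F$ over $\mathcal X$, and a finite set $\Phi\subseteq\operatorname{End}(F)$. $\Phi^*$ denotes the free monoid on $\Phi$; its elements are words $\sigma=\sigma_1\cdots\sigma_n$ ($\sigma_i\in\Phi$), acting on $F$ as endomorphisms. Maps act from the right, so $\sigma\delta$ means first $\sigma$, then $\delta$; the empty word is the identity $\mathrm{id}$. The $L$-presentation defines the group $F/K$, where $K$ is the normal closure in $F$ of $\mathcal Q\cup\bigcup_{\sigma\in\Phi^*}\mathcal R^\sigma$. It is invariant if $K^\varphi\subseteq K$ for every $\varphi\in\Phi$; a group is invariantly finitely $L$-presented if it is isomorphic to a group defined by some invariant finite $L$-presentation. Let $\mathcal U\le G=F/K$ have finite index and let $UK\le F$ be its full preimage in $F$. Let $\varphi\colon F\to\operatorname{Sym}(UK\backslash F)$ be the permutation representation given by right multiplication on the right cosets of $UK$. For $\sigma\in\Phi^*$, $\sigma\varphi\colon F\to\operatorname{Sym}(UK\backslash F)$ is the composition $g\mapsto (g^\sigma)^\varphi$. Fix a total ordering $\prec$ on $\Phi$ and extend it to the length-plus-(from the right)-lexicographic well-ordering on $\Phi^*$: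 $\sigma\prec\delta$ if $\sigma$ is a shorter word than $\delta$, or if $\sigma=\sigma_1\cdots\sigma_n$ and $\delta=\delta_1\cdots\delta_n$ have the same length and there is $1\le k\le n$ with $\sigma_i=\delta_i$ for all $k<i\le n$ and $\sigma_k\prec\delta_k$. Let $V\subseteq\Phi^*$ be the finite set consisting, for each homomorphism in $\{\sigma\varphi:\sigma\in\Phi^*\}$, of the $\prec$-least $\sigma\in\Phi^*$ inducing it. The subgroup $\mathcal U$ is leaf-invariant (with respect to the given $L$-presentation) if $\psi\delta\varphi=\varphi$ for all $\psi\in\Phi$ and $\delta\in V$ with $\psi\delta\notin V$. *)

theory Defs
  imports "HOL-Algebra.Coset" "HOL-Algebra.Bij"
begin

section \<open>Free groups\<close>

text \<open>The letter \<open>(x, True)\<close> is the generator \<open>x\<close>, the letter \<open>(x, False)\<close> is its inverse.\<close>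

type_synonym 'a letter = "'a \<times> bool"

definition inv_letter :: "'a letter \<Rightarrow> 'a letter" where
  "inv_letter a = (fst a, \<not> snd a)"

definition reduced :: "'a letter list \<Rightarrow> bool" where
  "reduced w \<longleftrightarrow> successively (\<lambda>a b. b \<noteq> inv_letter a) w"

fun lcons :: "'a letter \<Rightarrow> 'a letter list \<Rightarrow> 'a letter list" where
  "lcons a [] = [a]"
| "lcons a (b # w) = (if b = inv_letter a then w else a # b # w)"

text \<open>The free group over \<open>X\<close> in its normal form model: the elements are the reduced words, and
  the product of two reduced words is the reduced form of their concatenation.\<close>

definition free_group :: "'a set \<Rightarrow> 'a letter list monoid" where
  "free_group X =
    \<lparr>carrier = {w. set w \<subseteq> X \<times> UNIV \<and> reduced w}, mult = (\<lambda>u v. foldr lcons u v), one = []\<rparr>"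

lemma inv_letter_invol [simp]: "inv_letter (inv_letter a) = a"
  by (simp add: inv_letter_def)

lemma inv_letter_neq [simp]: "inv_letter a \<noteq> a" "a \<noteq> inv_letter a"
  by (auto simp: inv_letter_def prod_eq_iff)

lemma reduced_ConsD: "reduced (a # w) \<Longrightarrow> reduced w"
  by (cases w) (auto simp: reduced_def)

lemma reduced_lcons: "reduced w \<Longrightarrow> reduced (lcons a w)"
  by (cases w) (auto simp: reduced_def dest: reduced_ConsD[unfolded reduced_def])

lemma lcons_reduced: "reduced (a # w) \<Longrightarrow> lcons a w = a # w"
  by (cases w) (auto simp: reduced_def)

lemma set_lcons: "set (lcons a w) \<subseteq> insert a (set w)"
  by (cases w) auto

lemma lcons_inv: "reduced w \<Longrightarrow> lcons a (lcons (inv_letter a) w) = w"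
  by (cases w) (auto simp: lcons_reduced)

lemma reduced_foldr_lcons: "reduced w \<Longrightarrow> reduced (foldr lcons u w)"
  by (induction u) (auto intro: reduced_lcons)

lemma set_foldr_lcons: "set (foldr lcons u w) \<subseteq> set u \<union> set w"
proof (induction u)
  case (Cons a u)
  then show ?case using set_lcons[of a "foldr lcons u w"] by auto
qed simp

lemma foldr_lcons_lcons:
  "reduced w \<Longrightarrow> foldr lcons (lcons a v) w = lcons a (foldr lcons v w)"
  by (cases v) (auto simp: lcons_inv reduced_foldr_lcons)

lemma foldr_lcons_assoc:
  "reduced w \<Longrightarrow> foldr lcons (foldr lcons u v) w = foldr lcons u (foldr lcons v w)"
  by (induction u) (auto simp: foldr_lcons_lcons)

lemma foldr_lcons_Nil: "reduced w \<Longrightarrow> foldr lcons w [] = w"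
  by (induction w) (simp_all add: lcons_reduced reduced_ConsD)

lemma foldr_lcons_inverse:
  "reduced w \<Longrightarrow> foldr lcons (map inv_letter (rev u)) (foldr lcons u w) = w"
proof (induction u arbitrary: w)
  case (Cons a u)
  then show ?case
    using lcons_inv[of "foldr lcons u w" "inv_letter a"] by (auto simp: reduced_foldr_lcons)
qed simp

lemma free_group_group: "group (free_group X)"
proof (rule groupI)
  fix u assume u: "u \<in> carrier (free_group X)"
  define v where "v = foldr lcons (map inv_letter (rev u)) []"
  have red: "reduced []" by (simp add: reduced_def)
  have "set v \<subseteq> X \<times> UNIV"
    using u set_foldr_lcons[of "map inv_letter (rev u)" "[]"]
    by (force simp: v_def free_group_def inv_letter_def)
  then have "v \<in> carrier (free_group X)"
    by (simp add: free_group_def v_def reduced_foldr_lcons red)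
  moreover have "foldr lcons v u = []"
    using u foldr_lcons_inverse[OF red, of u]
    by (simp add: v_def free_group_def foldr_lcons_assoc foldr_lcons_Nil)
  ultimately show "\<exists>v\<in>carrier (free_group X). v \<otimes>\<^bsub>free_group X\<^esub> u = \<one>\<^bsub>free_group X\<^esub>"
    by (auto simp: free_group_def)
next
  fix u v assume "u \<in> carrier (free_group X)" "v \<in> carrier (free_group X)"
  then show "u \<otimes>\<^bsub>free_group X\<^esub> v \<in> carrier (free_group X)"
    using set_foldr_lcons[of u v] by (auto simp: free_group_def reduced_foldr_lcons)
qed (auto simp: free_group_def foldr_lcons_assoc, simp_all add: reduced_def)

definition normal_closure :: "('g, 'm) monoid_scheme \<Rightarrow> 'g set \<Rightarrow> 'g set" where
  "normal_closure F S = \<Inter>{N. N \<lhd> F \<and> S \<subseteq> N}"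

section \<open>$L$-presentations\<close>

type_synonym 'a endo = "'a letter list \<Rightarrow> 'a letter list"

record 'a lpres =
  gens :: "'a set"
  fixed_rels :: "'a letter list set"
  endos :: "'a endo set"
  iter_rels :: "'a letter list set"

abbreviation free_of :: "'a lpres \<Rightarrow> 'a letter list monoid" where
  "free_of L \<equiv> free_group (gens L)"

text \<open>Endomorphisms are taken to be extensional, so that two elements of \<open>endos L\<close> are equal
  exactly if they agree on the free group.\<close>

definition finite_lpres :: "'a lpres \<Rightarrow> bool" where
  "finite_lpres L \<longleftrightarrow>
     finite (gens L) \<and>
     finite (fixed_rels L) \<and> fixed_rels L \<subseteq> carrier (free_of L) \<and>
     finite (iter_rels L) \<and> iter_rels L \<subseteq> carrier (free_of L) \<and>
     finite (endos L) \<and> endos L \<subseteq> hom (free_of L) (free_of L) \<inter> extensional (carrier (free_of L))"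

text \<open>The free monoid on \<open>endos L\<close> is \<open>lists (endos L)\<close>. Maps act from the right: in a word the
  leftmost endomorphism is applied first.\<close>

definition word_act :: "'a endo list \<Rightarrow> 'a endo" where
  "word_act \<sigma> g = fold (\<lambda>\<phi> h. \<phi> h) \<sigma> g"

definition lp_kernel :: "'a lpres \<Rightarrow> 'a letter list set" where
  "lp_kernel L =
     normal_closure (free_of L)
       (fixed_rels L \<union> (\<Union>\<sigma>\<in>lists (endos L). word_act \<sigma> ` iter_rels L))"

definition lp_group :: "'a lpres \<Rightarrow> 'a letter list set monoid" where
  "lp_group L = free_of L Mod lp_kernel L"

definition invariant_lpres :: "'a lpres \<Rightarrow> bool" where
  "invariant_lpres L \<longleftrightarrow> (\<forall>\<phi>\<in>endos L. \<phi> ` lp_kernel L \<subseteq> lp_kernel L)"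

text \<open>Every finite alphabet is in bijection with a finite set of natural numbers, so the
  restriction to alphabets of type \<^typ>\<open>nat\<close> loses no group.\<close>

definition invariantly_finitely_L_presented :: "('g, 'm) monoid_scheme \<Rightarrow> bool" where
  "invariantly_finitely_L_presented G \<longleftrightarrow>
     (\<exists>L :: nat lpres. finite_lpres L \<and> invariant_lpres L \<and> G \<cong> lp_group L)"

section \<open>Leaf-invariant subgroups\<close>

definition full_preimage :: "'a lpres \<Rightarrow> 'a letter list set set \<Rightarrow> 'a letter list set" where
  "full_preimage L U = {g \<in> carrier (free_of L). lp_kernel L #>\<^bsub>free_of L\<^esub> g \<in> U}"

definition coset_perm :: "('g, 'm) monoid_scheme \<Rightarrow> 'g set \<Rightarrow> 'g \<Rightarrow> 'g set \<Rightarrow> 'g set" where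
  "coset_perm F H = (\<lambda>g\<in>carrier F. \<lambda>C\<in>rcosets\<^bsub>F\<^esub> H. C #>\<^bsub>F\<^esub> g)"

lemma coset_perm_BijGroup:
  fixes F (structure)
  assumes "group F" and "subgroup H F" and "g \<in> carrier F"
  shows "coset_perm F H g \<in> carrier (BijGroup (rcosets H))"
proof -
  interpret group F by fact
  have sub: "C \<subseteq> carrier F" if "C \<in> rcosets H" for C
    using that assms(2) subgroup.rcosets_carrier is_group by blast
  have cl: "C #> x \<in> rcosets H" if "C \<in> rcosets H" "x \<in> carrier F" for C x
    using that assms(2) by (auto simp: RCOSETS_def coset_mult_assoc subgroup.subset)
  have "bij_betw (\<lambda>C. C #> g) (rcosets H) (rcosets H)"
    by (rule bij_betw_byWitness[where f' = "\<lambda>C. C #> inv g"])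
       (use assms(3) sub cl in \<open>auto simp: coset_mult_assoc\<close>)
  then show ?thesis
    using assms(3) by (simp add: coset_perm_def BijGroup_def Bij_def cong: bij_betw_cong)
qed

text \<open>The homomorphism \<open>\<sigma>\<phi>\<close> from the free group to the symmetric group on the right cosets of the
  full preimage of \<open>U\<close>; for \<open>\<sigma> = []\<close> it is the permutation representation \<open>\<phi>\<close> itself.\<close>

definition word_perm ::
    "'a lpres \<Rightarrow> 'a letter list set set \<Rightarrow> 'a endo list
      \<Rightarrow> 'a letter list \<Rightarrow> 'a letter list set \<Rightarrow> 'a letter list set" where
  "word_perm L U \<sigma> =
     (\<lambda>g\<in>carrier (free_of L). coset_perm (free_of L) (full_preimage L U) (word_act \<sigma> g))"

definition word_less :: "('b \<times> 'b) set \<Rightarrow> 'b list \<Rightarrow> 'b list \<Rightarrow> bool" where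
  "word_less r \<sigma> \<delta> \<longleftrightarrow>
     length \<sigma> < length \<delta> \<or>
     length \<sigma> = length \<delta> \<and>
     (\<exists>k<length \<sigma>. (\<forall>i. k < i \<and> i < length \<sigma> \<longrightarrow> \<sigma> ! i = \<delta> ! i) \<and> (\<sigma> ! k, \<delta> ! k) \<in> r)"

definition least_words ::
    "'a lpres \<Rightarrow> ('a endo \<times> 'a endo) set \<Rightarrow> 'a letter list set set \<Rightarrow> 'a endo list set" where
  "least_words L r U =
     {\<sigma> \<in> lists (endos L).
        \<forall>\<delta>\<in>lists (endos L). word_perm L U \<delta> = word_perm L U \<sigma> \<longrightarrow> \<delta> = \<sigma> \<or> word_less r \<sigma> \<delta>}"

definition leaf_invariant ::
    "'a lpres \<Rightarrow> ('a endo \<times> 'a endo) set \<Rightarrow> 'a letter list set set \<Rightarrow> bool" where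
  "leaf_invariant L r U \<longleftrightarrow>
     (\<forall>\<psi>\<in>endos L. \<forall>\<delta>\<in>least_words L r U.
        \<psi> # \<delta> \<notin> least_words L r U \<longrightarrow> word_perm L U (\<psi> # \<delta>) = word_perm L U [])"

end

theory Submission
  imports Defs
begin

text \<open>
  Let \<open>F\<close> be the free group, \<open>K\<close> the kernel and \<open>H\<close> the full preimage of \<open>U\<close>. Every word \<open>\<sigma>\<close> factors as
  \<open>v \<omega>\<^sub>1 \<dots> \<omega>\<^sub>k\<close> with \<open>v\<close> in the finite set \<open>V\<close> of least words and each \<open>\<omega>\<^sub>i\<close> a leaf, that is, of the
  form \<open>\<psi> \<delta>\<close> with \<open>\<delta> \<in> V\<close> and \<open>\<psi> \<delta> \<notin> V\<close>. Leaf-invariance says that a leaf maps every right coset of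
  \<open>H\<close> into itself. Hence leaves restrict to endomorphisms of \<open>H\<close>, and they permute the conjugates of a
  relator by a transversal \<open>T\<close> of \<open>H\<close> up to conjugation in \<open>H\<close>. So \<open>K\<close> is the normal closure in \<open>H\<close> of the
  conjugates \<open>t q t\<inverse>\<close> together with the images of the \<open>t r\<^sup>v t\<inverse>\<close> under words in the leaves.

  The Nielsen-Schreier theorem is not needed: it suffices that Reidemeister-Schreier rewriting
  \<open>\<tau> : H \<rightarrow> E\<close> embeds \<open>H\<close> as a retract, with retraction \<open>\<pi>\<close>, of a free group \<open>E\<close> of finite rank. An
  endomorphism \<open>w\<close> of \<open>H\<close> lifts to \<open>\<tau> w \<pi>\<close> (first \<open>\<pi>\<close>), and the kernel of \<open>\<pi>\<close> is killed by the finitely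
  many relators \<open>\<tau> (\<pi> y) y\<inverse>\<close> for generators \<open>y\<close> of \<open>E\<close>.
\<close>

section \<open>Homomorphisms and cocycles on free groups\<close>

lemma mult_free_group: "u \<otimes>\<^bsub>free_group X\<^esub> v = foldr lcons u v"
  by (simp add: free_group_def)

lemma one_free_group: "\<one>\<^bsub>free_group X\<^esub> = []"
  by (simp add: free_group_def)

lemma letter_in_free_group: "[a] \<in> carrier (free_group X) \<longleftrightarrow> fst a \<in> X"
  by (cases a) (auto simp: free_group_def reduced_def)

lemma inv_letter_free_group:
  assumes "fst a \<in> X"
  shows "inv\<^bsub>free_group X\<^esub> [a] = [inv_letter a]"
proof -
  interpret group "free_group X" by (rule free_group_group)
  show ?thesis
    by (rule inv_equality)
      (use assms in \<open>auto simp: mult_free_group one_free_group letter_in_free_group inv_letter_def\<close>)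
qed

text \<open>A reduced word \<open>a # w\<close> is the product of \<open>[a]\<close> and
  \<open>w\<close> with no cancellation, so list induction can proceed one group multiplication at a
  time.\<close>

lemma free_group_induct [consumes 1, case_names one letter]:
  assumes "w \<in> carrier (free_group X)"
    and "P []"
    and "\<And>a w. fst a \<in> X \<Longrightarrow> w \<in> carrier (free_group X)
      \<Longrightarrow> a # w = [a] \<otimes>\<^bsub>free_group X\<^esub> w \<Longrightarrow> P w \<Longrightarrow> P (a # w)"
  shows "P w"
  using assms(1)
proof (induction w)
  case (Cons a w)
  then have red: "reduced (a # w)" by (simp add: free_group_def)
  have w: "w \<in> carrier (free_group X)" and a: "fst a \<in> X"
    using Cons.prems reduced_ConsD[OF red] by (auto simp: free_group_def)
  have "a # w = [a] \<otimes>\<^bsub>free_group X\<^esub> w"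
    using red by (simp add: mult_free_group lcons_reduced)
  then show ?case
    using assms(3)[OF a w _ Cons.IH[OF w]] by blast
qed (rule assms(2))

text \<open>The uniqueness half of the universal property. A negative letter is the inverse of a
  positive one, so positive letters decide.\<close>

lemma free_group_hom_eq:
  assumes "group G" and h: "h \<in> hom (free_group X) G" and k: "k \<in> hom (free_group X) G"
    and gens: "\<And>x. x \<in> X \<Longrightarrow> h [(x, True)] = k [(x, True)]"
    and "w \<in> carrier (free_group X)"
  shows "h w = k w"
proof -
  interpret F: group "free_group X" by (rule free_group_group)
  interpret h: group_hom "free_group X" G h
    by (intro group_hom.intro group_hom_axioms.intro F.group_axioms assms)
  interpret k: group_hom "free_group X" G k
    by (intro group_hom.intro group_hom_axioms.intro F.group_axioms assms)
  have letter_eq: "h [a] = k [a]" if a: "fst a \<in> X" for a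
  proof (cases "snd a")
    case True
    then show ?thesis using gens[OF a] by (cases a) auto
  next
    case False
    then have "[a] = inv\<^bsub>free_group X\<^esub> [(fst a, True)]"
      using a by (cases a) (simp add: inv_letter_free_group inv_letter_def)
    then show ?thesis
      using gens[OF a] a by (simp add: letter_in_free_group)
  qed
  from \<open>w \<in> carrier (free_group X)\<close> show ?thesis
  proof (induction rule: free_group_induct)
    case one
    then show ?case using h.hom_one k.hom_one by (simp add: one_free_group)
  next
    case (letter a w)
    then show ?case
      using letter_eq by (simp add: letter_in_free_group)
  qed
qed

text \<open>Letters act on states from \<open>S\<close> and emit values in \<open>G\<close>. The two
  inverse laws say that reading a letter and then its inverse restores the state and emits a trivial
  product, so the accumulated value respects free cancellation. A single state gives homomorphisms;
  the right cosets of a subgroup as states give Reidemeister-Schreier rewriting.\<close>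

locale letter_cocycle = group G for G (structure) +
  fixes X :: "'x set" and S :: "'s set"
    and act :: "'s \<Rightarrow> 'x letter \<Rightarrow> 's" and val :: "'s \<Rightarrow> 'x letter \<Rightarrow> 'a"
  assumes act_closed: "\<lbrakk>s \<in> S; fst a \<in> X\<rbrakk> \<Longrightarrow> act s a \<in> S"
    and act_inv: "\<lbrakk>s \<in> S; fst a \<in> X\<rbrakk> \<Longrightarrow> act (act s a) (inv_letter a) = s"
    and val_closed: "\<lbrakk>s \<in> S; fst a \<in> X\<rbrakk> \<Longrightarrow> val s a \<in> carrier G"
    and val_inv: "\<lbrakk>s \<in> S; fst a \<in> X\<rbrakk> \<Longrightarrow> val s a \<otimes> val (act s a) (inv_letter a) = \<one>"
begin

primrec cocycle :: "'s \<Rightarrow> 'x letter list \<Rightarrow> 'a" where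
  "cocycle s [] = \<one>"
| "cocycle s (a # w) = val s a \<otimes> cocycle (act s a) w"

lemma cocycle_closed:
  "\<lbrakk>s \<in> S; set w \<subseteq> X \<times> UNIV\<rbrakk> \<Longrightarrow> cocycle s w \<in> carrier G"
proof (induction w arbitrary: s)
  case (Cons a w)
  then have "fst a \<in> X" by auto
  then show ?case using Cons by (simp add: act_closed val_closed)
qed simp

text \<open>If \<open>lcons\<close> cancels, the right-hand side has two extra factors, whose
  product is trivial by \<open>val_inv\<close>, and the state is restored by
  \<open>act_inv\<close>.\<close>

lemma cocycle_lcons:
  assumes "s \<in> S" "fst a \<in> X" "set w \<subseteq> X \<times> UNIV"
  shows "cocycle s (lcons a w) = val s a \<otimes> cocycle (act s a) w"
proof (cases w)
  case (Cons b v)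
  show ?thesis
  proof (cases "b = inv_letter a")
    case True
    have a': "fst (inv_letter a) \<in> X" using assms(2) by (simp add: inv_letter_def)
    have v: "set v \<subseteq> X \<times> UNIV" using assms(3) Cons by simp
    show ?thesis
      using Cons True assms(1,2) a' v
      by (simp add: act_inv act_closed val_closed val_inv cocycle_closed flip: m_assoc)
  qed (simp add: Cons)
qed simp

text \<open>The crossed-homomorphism law. It becomes multiplicativity as soon as \<open>u\<close>
  fixes the state \<open>s\<close>.\<close>

lemma cocycle_mult:
  assumes "s \<in> S" "u \<in> carrier (free_group X)" "v \<in> carrier (free_group X)"
  shows "cocycle s (u \<otimes>\<^bsub>free_group X\<^esub> v) = cocycle s u \<otimes> cocycle (foldl act s u) v"
proof -
  have "cocycle s (foldr lcons u v) = cocycle s u \<otimes> cocycle (foldl act s u) v"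
    if "set u \<subseteq> X \<times> UNIV" "set v \<subseteq> X \<times> UNIV"
    using assms(1) that
  proof (induction u arbitrary: s)
    case Nil
    then show ?case by (simp add: cocycle_closed)
  next
    case (Cons a u)
    have a: "fst a \<in> X" and u: "set u \<subseteq> X \<times> UNIV" using Cons.prems by auto
    have "set (foldr lcons u v) \<subseteq> X \<times> UNIV"
      using set_foldr_lcons[of u v] u Cons.prems by blast
    moreover have "foldl act (act s a) u \<in> S"
      using u act_closed[OF Cons.prems(1) a]
      by (induction u arbitrary: s rule: rev_induct) (auto simp: act_closed)
    ultimately show ?case
      using Cons a u
      by (simp add: cocycle_lcons act_closed val_closed cocycle_closed m_assoc)
  qed
  then show ?thesis
    using assms(2,3) by (simp add: free_group_def)
qed

end

text \<open>The existence half of the universal property, as a cocycle with the single state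
  \<open>0\<close>.\<close>

lemma free_group_lift:
  assumes "group G" and f: "\<And>x. x \<in> X \<Longrightarrow> f x \<in> carrier G"
  obtains h where "h \<in> hom (free_group X) G" and "\<And>x. x \<in> X \<Longrightarrow> h [(x, True)] = f x"
proof -
  interpret group G by fact
  interpret letter_cocycle G X "{0 :: nat}" "\<lambda>s _. s"
      "\<lambda>_ a. if snd a then f (fst a) else inv\<^bsub>G\<^esub> f (fst a)"
    by unfold_locales (auto simp: inv_letter_def f)
  have foldl_const: "foldl (\<lambda>s _. s) z w = z" for z :: nat and w
    by (induction w) auto
  show thesis
  proof (rule that[of "cocycle 0"])
    show "cocycle 0 \<in> hom (free_group X) G"
      using cocycle_mult[of 0]
      by (intro homI cocycle_closed) (auto simp: free_group_def foldl_const)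
    show "cocycle 0 [(x, True)] = f x" if "x \<in> X" for x
      using that f by simp
  qed
qed

section \<open>Finite-index subgroups are retracts of free groups\<close>

lemma (in group) rcoset_eq_iff:
  assumes "subgroup H G" "x \<in> carrier G" "y \<in> carrier G"
  shows "H #> x = H #> y \<longleftrightarrow> x \<otimes> inv y \<in> H"
proof
  assume "H #> x = H #> y"
  then have "x \<in> H #> y" using rcos_self[OF assms(2,1)] by simp
  then obtain h where "h \<in> H" "x = h \<otimes> y" by (auto simp: r_coset_def)
  then show "x \<otimes> inv y \<in> H"
    using assms by (simp add: m_assoc subgroup.mem_carrier)
next
  assume "x \<otimes> inv y \<in> H"
  moreover have "x = x \<otimes> inv y \<otimes> y" using assms by (simp add: m_assoc)
  ultimately have "x \<in> H #> y" unfolding r_coset_def by blast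
  then show "H #> x = H #> y"
    using repr_independence assms by metis
qed

text \<open>\<open>Y\<close> names one Schreier generator, possibly trivial, for each pair of a
  coset and an element of \<open>X\<close>. \<open>\<pi>\<close> evaluates these names in
  \<open>H\<close>, and \<open>\<tau>\<close> rewrites an element of \<open>H\<close> by following
  its letters through the cosets.\<close>

lemma retract_of_free_group:
  fixes X :: "'a set" and H :: "'a letter list set"
  defines "F \<equiv> free_group X"
  assumes "finite X" and H: "subgroup H F" and fin: "finite (rcosets\<^bsub>F\<^esub> H)"
  obtains Y :: "nat set" and \<pi> \<tau> where "finite Y"
    and "\<pi> \<in> hom (free_group Y) (F\<lparr>carrier := H\<rparr>)"
    and "\<tau> \<in> hom (F\<lparr>carrier := H\<rparr>) (free_group Y)"
    and "\<And>h. h \<in> H \<Longrightarrow> \<pi> (\<tau> h) = h"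
proof -
  interpret F: group F unfolding F_def by (rule free_group_group)
  interpret HG: group "F\<lparr>carrier := H\<rparr>" by (rule F.subgroup_imp_group[OF H])
  let ?C = "rcosets\<^bsub>F\<^esub> H"
  have letter_in: "[a] \<in> carrier F" if "fst a \<in> X" for a
    using that by (simp add: F_def letter_in_free_group)
  have inv_letter: "inv\<^bsub>F\<^esub> [a] = [inv_letter a]" if "fst a \<in> X" for a
    using that by (simp add: F_def inv_letter_free_group)
  have H_sub: "H \<subseteq> carrier F" using H by (rule subgroup.subset)
  have H_in: "H \<in> ?C" using F.rcosetsI[OF H_sub F.one_closed] H_sub by simp
  have sub: "C \<subseteq> carrier F" if "C \<in> ?C" for C
    using that H subgroup.rcosets_carrier F.is_group by blast
  have act: "C #>\<^bsub>F\<^esub> g \<in> ?C" if "C \<in> ?C" "g \<in> carrier F" for C g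
    using that H_sub by (auto simp: RCOSETS_def F.coset_mult_assoc)
  \<comment> \<open>The representative of \<open>H\<close> itself has to be the identity: it makes
    \<open>s H h = h\<close> for \<open>h\<close> in \<open>H\<close>, hence
    \<open>\<pi> (\<tau> h) = h\<close>.\<close>
  define t where "t C = (if C = H then \<one>\<^bsub>F\<^esub> else SOME g. g \<in> C)" for C
  have t_in: "t C \<in> C" if "C \<in> ?C" for C
  proof -
    have "\<exists>g. g \<in> C" using that F.rcos_self[OF _ H] by (auto simp: RCOSETS_def)
    then show ?thesis
      using H by (auto simp: t_def subgroup.one_closed intro: someI_ex)
  qed
  have t_car: "t C \<in> carrier F" if "C \<in> ?C" for C using t_in sub that by blast
  have t_coset: "H #>\<^bsub>F\<^esub> t C = C" if "C \<in> ?C" for C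
    using that t_in[OF that] F.repr_independence[OF _ _ H] by (auto simp: RCOSETS_def)
  \<comment> \<open>The Schreier element of the step from \<open>C\<close> along \<open>g\<close>.
    Inner representatives telescope in products, which is \<open>s_mult\<close>.\<close>
  define s where "s C g = t C \<otimes>\<^bsub>F\<^esub> g \<otimes>\<^bsub>F\<^esub> inv\<^bsub>F\<^esub> t (C #>\<^bsub>F\<^esub> g)" for C g
  have s_in: "s C g \<in> H" if "C \<in> ?C" "g \<in> carrier F" for C g
  proof -
    have "H #>\<^bsub>F\<^esub> (t C \<otimes>\<^bsub>F\<^esub> g) = C #>\<^bsub>F\<^esub> g"
      using that H_sub t_car by (simp add: t_coset flip: F.coset_mult_assoc)
    also have "\<dots> = H #>\<^bsub>F\<^esub> t (C #>\<^bsub>F\<^esub> g)" using t_coset act that by simp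
    finally show ?thesis
      unfolding s_def using F.rcoset_eq_iff[OF H] t_car act that by simp
  qed
  have s_mult: "s C (g \<otimes>\<^bsub>F\<^esub> g') = s C g \<otimes>\<^bsub>F\<^esub> s (C #>\<^bsub>F\<^esub> g) g'"
    if "C \<in> ?C" "g \<in> carrier F" "g' \<in> carrier F" for C g g'
  proof -
    note [simp] = t_car[OF that(1)] t_car[OF act[OF that(1,2)]]
      t_car[OF act[OF act[OF that(1,2)] that(3)]] that
    have [simp]: "inv\<^bsub>F\<^esub> b \<otimes>\<^bsub>F\<^esub> (b \<otimes>\<^bsub>F\<^esub> z) = z" if "b \<in> carrier F" "z \<in> carrier F" for b z
      using that by (simp flip: F.m_assoc)
    have "C #>\<^bsub>F\<^esub> (g \<otimes>\<^bsub>F\<^esub> g') = C #>\<^bsub>F\<^esub> g #>\<^bsub>F\<^esub> g'"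
      using sub[OF that(1)] by (simp add: F.coset_mult_assoc)
    then show ?thesis
      unfolding s_def by (simp add: F.m_assoc)
  qed
  have s_one: "s C \<one>\<^bsub>F\<^esub> = \<one>\<^bsub>F\<^esub>" if "C \<in> ?C" for C
    using that t_car sub[OF that] by (simp add: s_def)
  have "finite (?C \<times> X)" using fin \<open>finite X\<close> by simp
  then obtain enc :: "'a letter list set \<times> 'a \<Rightarrow> nat" where enc: "inj_on enc (?C \<times> X)"
    using finite_imp_inj_to_nat_seg by blast
  define Y where "Y = enc ` (?C \<times> X)"
  interpret E: group "free_group Y" by (rule free_group_group)
  have enc_in: "enc (C, x) \<in> Y" if "C \<in> ?C" "x \<in> X" for C x
    using that by (simp add: Y_def)
  define gen where "gen y = (case inv_into (?C \<times> X) enc y of (C, x) \<Rightarrow> s C [(x, True)])" for y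
  have gen_enc: "gen (enc (C, x)) = s C [(x, True)]" if "C \<in> ?C" "x \<in> X" for C x
    using that inv_into_f_f[OF enc, of "(C, x)"] by (simp add: gen_def)
  have "gen y \<in> carrier (F\<lparr>carrier := H\<rparr>)" if "y \<in> Y" for y
    using that gen_enc s_in letter_in by (auto simp: Y_def)
  then obtain \<pi> where \<pi>: "\<pi> \<in> hom (free_group Y) (F\<lparr>carrier := H\<rparr>)"
    and \<pi>_gen: "\<And>y. y \<in> Y \<Longrightarrow> \<pi> [(y, True)] = gen y"
    using free_group_lift[OF HG.is_group, of Y gen] by blast
  interpret \<pi>: group_hom "free_group Y" "F\<lparr>carrier := H\<rparr>" \<pi>
    by unfold_locales (rule \<pi>)
  let ?act = "\<lambda>C a. C #>\<^bsub>F\<^esub> [a]"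
  \<comment> \<open>A negative letter runs backwards along an edge of the coset graph. It gives the
    inverse of the generator of that edge, which is named after the coset where the edge starts,
    here \<open>?act C a\<close>.\<close>
  define val where "val C a =
    (if snd a then [(enc (C, fst a), True)] else [(enc (?act C a, fst a), False)])" for C a
  have act_inv: "?act (?act C a) (inv_letter a) = C" if "C \<in> ?C" "fst a \<in> X" for C a
    using that sub letter_in by (simp add: F.coset_mult_assoc flip: inv_letter)
  interpret rew: letter_cocycle "free_group Y" X ?C ?act val
  proof unfold_locales
    fix C and a :: "'a letter" assume C: "C \<in> ?C" and a: "fst a \<in> X"
    show "?act C a \<in> ?C" by (intro act C letter_in a)
    show "?act (?act C a) (inv_letter a) = C" by (rule act_inv[OF C a])
    show "val C a \<in> carrier (free_group Y)"
      using C a act letter_in by (simp add: val_def letter_in_free_group enc_in)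
    show "val C a \<otimes>\<^bsub>free_group Y\<^esub> val (?act C a) (inv_letter a) = \<one>\<^bsub>free_group Y\<^esub>"
      using act_inv[OF C a]
      by (auto simp: val_def mult_free_group one_free_group inv_letter_def)
  qed
  define \<tau> where "\<tau> = rew.cocycle H"
  have F_one: "\<one>\<^bsub>F\<^esub> = []" by (simp add: F_def one_free_group)
  note F_induct = free_group_induct[where X = X, folded F_def, consumes 1, case_names one letter]
  have foldl_act: "foldl ?act C w = C #>\<^bsub>F\<^esub> w" if "C \<in> ?C" "w \<in> carrier F" for C w
    using that(2,1)
  proof (induction w arbitrary: C rule: F_induct)
    case one
    then show ?case using sub[of C] F.coset_mult_one[of C] by (simp add: F_one)
  next
    case (letter a w)
    have a: "[a] \<in> carrier F" and w: "w \<in> carrier F" and C: "C \<in> ?C"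
      using letter.hyps letter.prems by (simp_all add: letter_in)
    have "C #>\<^bsub>F\<^esub> (a # w) = C #>\<^bsub>F\<^esub> [a] #>\<^bsub>F\<^esub> w"
      using letter.hyps(3) sub[OF C] a w by (simp add: F.coset_mult_assoc)
    then show ?case
      using letter.IH[of "C #>\<^bsub>F\<^esub> [a]"] act[OF C a] w by simp
  qed
  \<comment> \<open>Stated for every start coset, since after one letter the induction continues
    from another coset.\<close>
  have \<pi>_rew: "\<pi> (rew.cocycle C w) = s C w" if "w \<in> carrier F" "C \<in> ?C" for C w
    using that
  proof (induction w arbitrary: C rule: F_induct)
    case one
    then show ?case
      using s_one[of C] \<pi>.hom_one by (simp add: F_one one_free_group)
  next
    case (letter a w)
    have a: "[a] \<in> carrier F" and w: "w \<in> carrier F" and C: "C \<in> ?C"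
      using letter.hyps letter.prems by (simp_all add: letter_in)
    have Ca: "C #>\<^bsub>F\<^esub> [a] \<in> ?C" by (rule act[OF C a])
    have "\<pi> (val C a) = s C [a]"
    proof (cases "snd a")
      case True
      then have "a = (fst a, True)" by (simp add: prod_eq_iff)
      then show ?thesis
        using C letter.hyps(1) True by (metis val_def \<pi>_gen enc_in gen_enc)
    next
      case False
      let ?b = "(fst a, True)" and ?y = "enc (C #>\<^bsub>F\<^esub> [a], fst a)"
      have b: "[?b] \<in> carrier F" using letter.hyps(1) by (simp add: letter_in)
      have y: "?y \<in> Y" using Ca letter.hyps(1) by (rule enc_in)
      have "val C a = inv\<^bsub>free_group Y\<^esub> [(?y, True)]"
        using False y by (simp add: val_def inv_letter_free_group inv_letter_def)
      then have "\<pi> (val C a) = inv\<^bsub>F\<lparr>carrier := H\<rparr>\<^esub> s (C #>\<^bsub>F\<^esub> [a]) [?b]"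
        using y Ca letter.hyps(1) by (simp add: letter_in_free_group \<pi>_gen gen_enc)
      also have "\<dots> = inv\<^bsub>F\<^esub> s (C #>\<^bsub>F\<^esub> [a]) [?b]"
        using s_in[OF Ca b] H by simp
      \<comment> \<open>\<open>[a]\<close> and \<open>[?b]\<close> are inverse letters, so
        \<open>s_mult\<close> and \<open>s_one\<close> make the two Schreier elements inverse to
        each other.\<close>
      also have "\<dots> = s C [a]"
      proof (rule F.inv_equality)
        have inv: "[a] \<otimes>\<^bsub>F\<^esub> [?b] = \<one>\<^bsub>F\<^esub>"
          using False
          by (cases a) (simp add: F_def mult_free_group one_free_group inv_letter_def)
        show "s C [a] \<otimes>\<^bsub>F\<^esub> s (C #>\<^bsub>F\<^esub> [a]) [?b] = \<one>\<^bsub>F\<^esub>"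
          using s_mult[OF C a b] s_one[OF C] inv by simp
      qed (use s_in Ca b C a H_sub in auto)
      finally show ?thesis .
    qed
    moreover have "rew.cocycle (C #>\<^bsub>F\<^esub> [a]) w \<in> carrier (free_group Y)"
      using Ca w by (intro rew.cocycle_closed) (auto simp: F_def free_group_def)
    moreover have "s C (a # w) = s C [a] \<otimes>\<^bsub>F\<^esub> s (C #>\<^bsub>F\<^esub> [a]) w"
      using s_mult[OF C a w] letter.hyps(3) by simp
    moreover have "val C a \<in> carrier (free_group Y)"
      by (rule rew.val_closed[OF C letter.hyps(1)])
    ultimately show ?case
      using letter.IH[of "C #>\<^bsub>F\<^esub> [a]"] Ca by simp
  qed
  show thesis
  proof (rule that)
    show "finite Y" using \<open>finite (?C \<times> X)\<close> by (simp add: Y_def)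
    show "\<tau> \<in> hom (F\<lparr>carrier := H\<rparr>) (free_group Y)"
    proof (rule homI)
      fix u v assume u: "u \<in> carrier (F\<lparr>carrier := H\<rparr>)" and v: "v \<in> carrier (F\<lparr>carrier := H\<rparr>)"
      then have uv: "u \<in> carrier F" "v \<in> carrier F" using H_sub by auto
      then show "\<tau> u \<in> carrier (free_group Y)"
        unfolding \<tau>_def by (intro rew.cocycle_closed H_in) (simp add: F_def free_group_def)
      \<comment> \<open>An element of \<open>H\<close> fixes the coset \<open>H\<close>, so
        \<open>v\<close> is again read from the start state.\<close>
      have "H #>\<^bsub>F\<^esub> u = H" using u uv H by (simp add: F.coset_join2)
      then show "\<tau> (u \<otimes>\<^bsub>F\<lparr>carrier := H\<rparr>\<^esub> v) = \<tau> u \<otimes>\<^bsub>free_group Y\<^esub> \<tau> v"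
        using rew.cocycle_mult[OF H_in, of u v] uv foldl_act[OF H_in uv(1)]
        by (simp add: \<tau>_def F_def)
    qed
    show "\<pi> (\<tau> h) = h" if "h \<in> H" for h
    proof -
      have h: "h \<in> carrier F" using that H_sub by blast
      then have "H #>\<^bsub>F\<^esub> h = H" using that H by (simp add: F.coset_join2)
      then show ?thesis
        using \<pi>_rew[OF h H_in] h by (simp add: \<tau>_def s_def t_def)
    qed
  qed (rule \<pi>)
qed

section \<open>Lifting an $L$-presentation along the retraction\<close>

lemma normal_closure_normal:
  assumes "group G" and "S \<subseteq> carrier G"
  shows "normal_closure G S \<lhd> G"
proof -
  interpret group G by fact
  \<comment> \<open>The intersection of an empty family would be the whole type;
    \<open>carrier G\<close> is a member of this one.\<close>
  have ne: "carrier G \<in> {N. N \<lhd> G \<and> S \<subseteq> N}"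
    using assms(2) by (auto simp: normal_inv_iff subgroup_self)
  then have "subgroup (\<Inter>{N. N \<lhd> G \<and> S \<subseteq> N}) G"
    by (intro subgroups_Inter) (auto dest: normal_imp_subgroup)
  then show ?thesis
    unfolding normal_closure_def normal_inv_iff by (auto simp: normal_inv_iff)
qed

lemma subset_normal_closure: "S \<subseteq> normal_closure G S"
  by (auto simp: normal_closure_def)

lemma normal_closure_minimal: "N \<lhd> G \<Longrightarrow> S \<subseteq> N \<Longrightarrow> normal_closure G S \<subseteq> N"
  by (auto simp: normal_closure_def)

lemma word_act_Nil [simp]: "word_act [] g = g"
  and word_act_Cons [simp]: "word_act (\<phi> # \<sigma>) g = word_act \<sigma> (\<phi> g)"
  and word_act_append [simp]: "word_act (\<sigma> @ \<delta>) g = word_act \<delta> (word_act \<sigma> g)"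
  by (simp_all add: word_act_def)

text \<open>Lets a product of leaves be read as a word over the endomorphisms that the leaves
  induce.\<close>

lemma word_act_concat: "word_act (concat \<sigma>s) g = word_act (map word_act \<sigma>s) g"
  by (induction \<sigma>s arbitrary: g) simp_all

lemma word_act_hom: "\<sigma> \<in> lists (hom G G) \<Longrightarrow> word_act \<sigma> \<in> hom G G"
proof (induction \<sigma>)
  case (Cons \<phi> \<sigma>)
  then have "\<phi> \<in> hom G G" "word_act \<sigma> \<in> hom G G" by auto
  then have "word_act \<sigma> \<circ> \<phi> \<in> hom G G" by (rule hom_compose)
  moreover have "word_act \<sigma> \<circ> \<phi> = word_act (\<phi> # \<sigma>)" by (simp add: fun_eq_iff)
  ultimately show ?case by metis
qed (auto simp: hom_def)

lemma word_act_invariant: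
  "\<lbrakk>\<And>\<phi>. \<phi> \<in> \<Phi> \<Longrightarrow> \<phi> ` K \<subseteq> K; \<sigma> \<in> lists \<Phi>\<rbrakk> \<Longrightarrow> word_act \<sigma> ` K \<subseteq> K"
  by (induction \<sigma>) (auto simp: image_subset_iff)

lemma finite_rcosets_transversal:
  assumes "group G" "subgroup H G" "finite (rcosets\<^bsub>G\<^esub> H)"
  obtains T where "finite T" "T \<subseteq> carrier G"
    "\<And>g. g \<in> carrier G \<Longrightarrow> \<exists>t\<in>T. H #>\<^bsub>G\<^esub> g = H #>\<^bsub>G\<^esub> t"
proof -
  have "rcosets\<^bsub>G\<^esub> H = (\<lambda>g. H #>\<^bsub>G\<^esub> g) ` carrier G" by (auto simp: RCOSETS_def)
  then obtain T where "T \<subseteq> carrier G" "finite T" "rcosets\<^bsub>G\<^esub> H = (\<lambda>g. H #>\<^bsub>G\<^esub> g) ` T"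
    using finite_subset_image[OF assms(3), of _ "carrier G"] by (metis order_refl)
  then show thesis
    using that[of T] by (metis (mono_tags, lifting) \<open>rcosets\<^bsub>G\<^esub> H = (\<lambda>g. H #>\<^bsub>G\<^esub> g) ` carrier G\<close> image_iff)
qed

text \<open>Since \<open>w\<close> keeps every coset of \<open>H\<close>, it restricts to
  \<open>H\<close> and sends a conjugate of \<open>p\<close> by \<open>t\<close> to a conjugate of
  \<open>w p\<close> by an element of the same coset. Conjugates by a finite transversal therefore
  suffice as relators.\<close>

lemma finite_index_lpres:
  fixes X :: "'a set"
  defines "F \<equiv> free_group X"
  assumes "finite X" and H: "subgroup H F" and finH: "finite (rcosets\<^bsub>F\<^esub> H)"
    and W: "finite W" "W \<subseteq> hom F F"
    and W_coset: "\<And>w g. w \<in> W \<Longrightarrow> g \<in> carrier F \<Longrightarrow> H #>\<^bsub>F\<^esub> w g = H #>\<^bsub>F\<^esub> g"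
    and Q: "finite Q" "Q \<subseteq> carrier F" and P: "finite P" "P \<subseteq> carrier F"
    and K_eq: "K = normal_closure F (Q \<union> (\<Union>\<sigma>\<in>lists W. word_act \<sigma> ` P))"
    and KH: "K \<subseteq> H" and WK: "\<And>w. w \<in> W \<Longrightarrow> w ` K \<subseteq> K"
  obtains L :: "nat lpres" and \<pi> where "finite_lpres L" "invariant_lpres L"
    "\<pi> \<in> hom (free_of L) (F\<lparr>carrier := H\<rparr>)" "\<pi> ` carrier (free_of L) = H"
    "lp_kernel L = {e \<in> carrier (free_of L). \<pi> e \<in> K}"
proof -
  interpret F: group F unfolding F_def by (rule free_group_group)
  interpret HG: group "F\<lparr>carrier := H\<rparr>" by (rule F.subgroup_imp_group[OF H])
  have H_sub: "H \<subseteq> carrier F" using H by (rule subgroup.subset)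
  let ?conj = "\<lambda>f g. f \<otimes>\<^bsub>F\<^esub> g \<otimes>\<^bsub>F\<^esub> inv\<^bsub>F\<^esub> f"
  let ?S = "Q \<union> (\<Union>\<sigma>\<in>lists W. word_act \<sigma> ` P)"
  have word_hom: "word_act \<sigma> \<in> hom F F" if "\<sigma> \<in> lists W" for \<sigma>
    using that W(2) by (intro word_act_hom) auto
  have S_car: "?S \<subseteq> carrier F"
    using Q(2) P(2)
    by (auto simp del: in_lists_conv_set intro!: hom_in_carrier[OF word_hom])
  have K_normal: "K \<lhd> F" unfolding K_eq by (rule normal_closure_normal[OF F.is_group S_car])
  have K_sub: "subgroup K F" using K_normal by (rule normal_imp_subgroup)
  have SK: "?S \<subseteq> K" unfolding K_eq by (rule subset_normal_closure)
  have PK: "P \<subseteq> K"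
  proof
    fix p assume "p \<in> P"
    then have "word_act [] p \<in> ?S" by (blast intro: lists.Nil)
    then show "p \<in> K" using SK by auto
  qed
  have conjK: "?conj f k \<in> K" if "f \<in> carrier F" "k \<in> K" for f k
    using K_normal that by (simp add: F.normal_inv_iff)
  have in_H: "g \<in> H \<longleftrightarrow> H #>\<^bsub>F\<^esub> g = H" if "g \<in> carrier F" for g
    using that F.coset_join1[OF _ _ H] F.coset_join2[OF _ H] by blast
  have W_car: "w g \<in> carrier F" if "w \<in> W" "g \<in> carrier F" for w g
    using that W(2) hom_in_carrier[of w F F g] by auto
  have WH: "w h \<in> H" if "w \<in> W" "h \<in> H" for w h
  proof -
    have h: "h \<in> carrier F" using that H_sub by auto
    then have "w h \<in> carrier F" by (rule W_car[OF that(1)])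
    then show ?thesis using in_H[OF h] in_H W_coset[OF that(1) h] that(2) by metis
  qed
  have word_coset: "H #>\<^bsub>F\<^esub> word_act \<sigma> g = H #>\<^bsub>F\<^esub> g" if "\<sigma> \<in> lists W" "g \<in> carrier F" for \<sigma> g
    using that
  proof (induction \<sigma> arbitrary: g)
    case (Cons w \<sigma>)
    then have "w \<in> W" "\<sigma> \<in> lists W" by auto
    moreover have "w g \<in> carrier F"
      using \<open>w \<in> W\<close> Cons.prems by (rule W_car)
    ultimately show ?case
      using Cons.IH W_coset[OF _ Cons.prems] by simp
  qed simp
  obtain T where T: "finite T" "T \<subseteq> carrier F"
    and T_cover: "\<And>g. g \<in> carrier F \<Longrightarrow> \<exists>t\<in>T. H #>\<^bsub>F\<^esub> g = H #>\<^bsub>F\<^esub> t"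
    using finite_rcosets_transversal[OF F.is_group H finH] by metis
  obtain Y :: "nat set" and \<pi> \<tau> where "finite Y"
    and \<pi>: "\<pi> \<in> hom (free_group Y) (F\<lparr>carrier := H\<rparr>)"
    and \<tau>: "\<tau> \<in> hom (F\<lparr>carrier := H\<rparr>) (free_group Y)"
    and \<pi>\<tau>: "\<And>h. h \<in> H \<Longrightarrow> \<pi> (\<tau> h) = h"
    using retract_of_free_group[OF \<open>finite X\<close>] H finH unfolding F_def by metis
  let ?E = "free_group Y"
  interpret E: group ?E by (rule free_group_group)
  interpret \<pi>: group_hom ?E "F\<lparr>carrier := H\<rparr>" \<pi> by unfold_locales (rule \<pi>)
  interpret \<tau>: group_hom "F\<lparr>carrier := H\<rparr>" ?E \<tau> by unfold_locales (rule \<tau>)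
  have \<pi>_in: "\<pi> e \<in> H" if "e \<in> carrier ?E" for e using \<pi>.hom_closed[OF that] by simp
  have \<tau>_in: "\<tau> h \<in> carrier ?E" if "h \<in> H" for h using \<tau>.hom_closed that by simp
  \<comment> \<open>The restriction makes the lift extensional, as \<open>finite_lpres\<close>
    demands.\<close>
  define lift where "lift w = restrict (\<tau> \<circ> w \<circ> \<pi>) (carrier ?E)" for w
  have lift_\<tau>: "lift w (\<tau> h) = \<tau> (w h)" if "h \<in> H" for w h
    using that \<tau>_in by (simp add: lift_def \<pi>\<tau>)
  have lift_word: "word_act (map lift \<sigma>) (\<tau> h) = \<tau> (word_act \<sigma> h)"
    if "\<sigma> \<in> lists W" "h \<in> H" for \<sigma> h
    using that by (induction \<sigma> arbitrary: h) (auto simp: lift_\<tau> WH)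
  define M where "M = (\<lambda>y. \<tau> (\<pi> [(y, True)]) \<otimes>\<^bsub>?E\<^esub> inv\<^bsub>?E\<^esub> [(y, True)]) ` Y"
  define L where "L = \<lparr>gens = Y,
    fixed_rels = M \<union> (\<lambda>(t, q). \<tau> (?conj t q)) ` (T \<times> Q),
    endos = lift ` W,
    iter_rels = (\<lambda>(t, p). \<tau> (?conj t p)) ` (T \<times> P)\<rparr>"
  have free_L [simp]: "free_of L = ?E" by (simp add: L_def)
  have conjH: "?conj f k \<in> H" if "f \<in> carrier F" "k \<in> K" for f k
    using conjK[OF that] KH by blast
  have rel_H: "?conj t g \<in> H" if "t \<in> T" "g \<in> Q \<union> P" for t g
    using that conjH T(2) SK PK by blast
  have M_car: "M \<subseteq> carrier ?E"
    by (auto simp: M_def \<tau>_in \<pi>_in letter_in_free_group)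
  have lift_hom: "lift w \<in> hom ?E ?E" if "w \<in> W" for w
  proof -
    have "w \<in> hom (F\<lparr>carrier := H\<rparr>) (F\<lparr>carrier := H\<rparr>)"
      using that W(2) WH H_sub by (auto simp: hom_def Pi_def subset_iff)
    then have "\<tau> \<circ> w \<circ> \<pi> \<in> hom ?E ?E"
      using hom_compose[OF \<pi>] hom_compose[OF _ \<tau>] by (metis comp_assoc)
    then show ?thesis by (auto simp: hom_def lift_def Pi_def)
  qed
  have fin: "finite_lpres L"
    unfolding finite_lpres_def
    using \<open>finite Y\<close> T Q P W M_car rel_H \<tau>_in lift_hom
    by (auto simp: L_def M_def lift_def)
  let ?R = "fixed_rels L \<union> (\<Union>\<sigma>\<in>lists (endos L). word_act \<sigma> ` iter_rels L)"
  have R_iter: "\<tau> (word_act \<sigma> (?conj t p)) \<in> ?R" if "\<sigma> \<in> lists W" "t \<in> T" "p \<in> P" for \<sigma> t p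
  proof -
    have "map lift \<sigma> \<in> lists (endos L)" using that(1) by (auto simp: L_def lists_image)
    moreover have "\<tau> (?conj t p) \<in> iter_rels L" using that(2,3) by (auto simp: L_def)
    ultimately have "word_act (map lift \<sigma>) (\<tau> (?conj t p)) \<in> ?R" by blast
    moreover have "?conj t p \<in> H" using that(2,3) rel_H by blast
    ultimately show ?thesis using lift_word[OF that(1)] by simp
  qed
  \<comment> \<open>The intended kernel, the preimage of \<open>K\<close> under
    \<open>\<pi>\<close>. That it is normal and contains all relators gives one inclusion.\<close>
  define N where "N = {e \<in> carrier ?E. \<pi> e \<in> K}"
  have N_normal: "N \<lhd> ?E"
    unfolding E.normal_inv_iff
  proof (intro conjI ballI)
    show "subgroup N ?E"
      using K_sub H by unfold_locales
        (auto simp: N_def subgroup.m_closed subgroup.one_closed subgroup.m_inv_closed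
          \<pi>.hom_one[simplified] \<pi>_in)
    show "x \<otimes>\<^bsub>?E\<^esub> h \<otimes>\<^bsub>?E\<^esub> inv\<^bsub>?E\<^esub> x \<in> N" if "x \<in> carrier ?E" "h \<in> N" for x h
      using that conjK[of "\<pi> x" "\<pi> h"] \<pi>_in H_sub H by (auto simp: N_def)
  qed
  have \<tau>_N: "\<tau> k \<in> N" if "k \<in> K" for k
    using that KH \<tau>_in \<pi>\<tau> by (auto simp: N_def)
  have M_N: "M \<subseteq> N"
  proof
    fix m assume "m \<in> M"
    then obtain y where y: "y \<in> Y"
      and m: "m = \<tau> (\<pi> [(y, True)]) \<otimes>\<^bsub>?E\<^esub> inv\<^bsub>?E\<^esub> [(y, True)]"
      by (auto simp: M_def)
    have Y: "[(y, True)] \<in> carrier ?E" using y by (simp add: letter_in_free_group)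
    have "\<pi> m = \<pi> [(y, True)] \<otimes>\<^bsub>F\<^esub> inv\<^bsub>F\<^esub> \<pi> [(y, True)]"
      using Y \<pi>_in[OF Y] H by (simp add: m \<tau>_in \<pi>\<tau>)
    then have "\<pi> m = \<one>\<^bsub>F\<^esub>" using \<pi>_in[OF Y] H_sub by (simp add: subset_iff)
    then show "m \<in> N"
      using \<open>m \<in> M\<close> M_car subgroup.one_closed[OF K_sub] by (auto simp: N_def)
  qed
  have R_N: "?R \<subseteq> N"
  proof -
    have "\<tau> (?conj t q) \<in> N" if "t \<in> T" "q \<in> Q" for t q
      using that T(2) SK by (intro \<tau>_N conjK) auto
    then have "fixed_rels L \<subseteq> N" using M_N by (auto simp: L_def)
    moreover have "word_act \<sigma>' r \<in> N"
      if \<sigma>': "\<sigma>' \<in> lists (endos L)" and r: "r \<in> iter_rels L" for \<sigma>' r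
    proof -
      obtain \<sigma> where \<sigma>: "\<sigma> \<in> lists W" "\<sigma>' = map lift \<sigma>"
        using \<sigma>' by (auto simp: L_def lists_image simp del: in_lists_conv_set)
      obtain t p where tp: "t \<in> T" "p \<in> P" "r = \<tau> (?conj t p)" using r by (auto simp: L_def)
      have K: "?conj t p \<in> K" using tp T(2) PK by (intro conjK) auto
      then have "word_act \<sigma> (?conj t p) \<in> K"
        using word_act_invariant[OF WK \<sigma>(1)] by blast
      then show ?thesis
        using lift_word[OF \<sigma>(1)] K KH \<tau>_N by (auto simp: \<sigma>(2) tp(3))
    qed
    ultimately show ?thesis by blast
  qed
  have R_car: "?R \<subseteq> carrier ?E" using R_N by (auto simp: N_def)
  have Kern_normal: "lp_kernel L \<lhd> ?E"
    using normal_closure_normal[OF E.is_group R_car] by (simp add: lp_kernel_def)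
  have R_kern: "?R \<subseteq> lp_kernel L"
    unfolding lp_kernel_def by (rule subset_normal_closure)
  interpret kern: normal "lp_kernel L" ?E by (rule Kern_normal)
  have conj_kern: "x \<otimes>\<^bsub>?E\<^esub> h \<otimes>\<^bsub>?E\<^esub> inv\<^bsub>?E\<^esub> x \<in> lp_kernel L"
    if "x \<in> carrier ?E" "h \<in> lp_kernel L" for x h
    using Kern_normal that by (simp add: E.normal_inv_iff)
  \<comment> \<open>Both sides are homomorphisms into the quotient by \<open>lp_kernel L\<close>,
    and the relators in \<open>M\<close> make them agree on generators.\<close>
  have \<tau>\<pi>_mod: "lp_kernel L #>\<^bsub>?E\<^esub> \<tau> (\<pi> e) = lp_kernel L #>\<^bsub>?E\<^esub> e" if "e \<in> carrier ?E" for e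
  proof (rule free_group_hom_eq[OF kern.factorgroup_is_group _ kern.r_coset_hom_Mod _ that])
    have "\<tau> \<circ> \<pi> \<in> hom ?E ?E" using \<pi> \<tau> by (rule hom_compose)
    then have "(\<lambda>e. lp_kernel L #>\<^bsub>?E\<^esub> e) \<circ> (\<tau> \<circ> \<pi>) \<in> hom ?E (?E Mod lp_kernel L)"
      using kern.r_coset_hom_Mod by (rule hom_compose)
    then show "(\<lambda>e. lp_kernel L #>\<^bsub>?E\<^esub> \<tau> (\<pi> e)) \<in> hom ?E (?E Mod lp_kernel L)"
      by (simp add: comp_def)
    fix y assume y: "y \<in> Y"
    then have Y: "[(y, True)] \<in> carrier ?E" by (simp add: letter_in_free_group)
    have "\<tau> (\<pi> [(y, True)]) \<otimes>\<^bsub>?E\<^esub> inv\<^bsub>?E\<^esub> [(y, True)] \<in> lp_kernel L"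
      using R_kern y by (auto simp: L_def M_def)
    then show "lp_kernel L #>\<^bsub>?E\<^esub> \<tau> (\<pi> [(y, True)]) = lp_kernel L #>\<^bsub>?E\<^esub> [(y, True)]"
      using E.rcoset_eq_iff[OF kern.subgroup_axioms \<tau>_in[OF \<pi>_in[OF Y]] Y] by blast
  qed
  have conj_mult: "?conj (f \<otimes>\<^bsub>F\<^esub> f') g = ?conj f (?conj f' g)"
    if "f \<in> carrier F" "f' \<in> carrier F" "g \<in> carrier F" for f f' g
    using that by (simp add: F.m_assoc F.inv_mult_group)
  \<comment> \<open>Passing from \<open>f\<close> to \<open>f'\<close> conjugates by
    \<open>?h\<close>, an element of \<open>H\<close>. On \<open>H\<close> the map
    \<open>\<tau>\<close> is a homomorphism, and \<open>lp_kernel L\<close> is normal.\<close>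
  have kern_coset: "\<tau> (?conj f' g) \<in> lp_kernel L"
    if g: "g \<in> K" and f: "f \<in> carrier F" "f' \<in> carrier F"
      and eq: "H #>\<^bsub>F\<^esub> f = H #>\<^bsub>F\<^esub> f'" and "\<tau> (?conj f g) \<in> lp_kernel L" for f f' g
  proof -
    let ?h = "f' \<otimes>\<^bsub>F\<^esub> inv\<^bsub>F\<^esub> f"
    have h: "?h \<in> H" using F.rcoset_eq_iff[OF H f(2,1)] eq by simp
    have g_car: "g \<in> carrier F" using g KH H_sub by blast
    have "f' = ?h \<otimes>\<^bsub>F\<^esub> f" using f by (simp add: F.m_assoc)
    then have "?conj f' g = ?conj ?h (?conj f g)"
      using conj_mult[of ?h f g] f g_car by simp
    moreover have "\<tau> (?conj ?h (?conj f g)) = \<tau> ?h \<otimes>\<^bsub>?E\<^esub> \<tau> (?conj f g) \<otimes>\<^bsub>?E\<^esub> inv\<^bsub>?E\<^esub> \<tau> ?h"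
      using \<tau>.hom_mult[of "?h \<otimes>\<^bsub>F\<^esub> ?conj f g" "inv\<^bsub>F\<^esub> ?h"] \<tau>.hom_mult[of ?h "?conj f g"]
        \<tau>.hom_inv[of ?h] h conjH[OF f(1) g] H
      by (simp add: subgroup.m_closed subgroup.m_inv_closed)
    ultimately show ?thesis
      using conj_kern[OF \<tau>_in[OF h] that(5)] by simp
  qed
  \<comment> \<open>\<open>K\<close> is a normal closure in \<open>F\<close>, not in \<open>H\<close>, so the subgroup to compare it with has to be closed
    under conjugation by all of \<open>F\<close>.\<close>
  define N' where "N' = {g \<in> K. \<forall>f\<in>carrier F. \<tau> (?conj f g) \<in> lp_kernel L}"
  have N'_normal: "N' \<lhd> F"
    unfolding F.normal_inv_iff
  proof (intro conjI ballI)
    have K_car: "K \<subseteq> carrier F" using KH H_sub by blast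
    show "subgroup N' F"
    proof
      show "N' \<subseteq> carrier F" using K_car by (auto simp: N'_def)
      show "\<one>\<^bsub>F\<^esub> \<in> N'"
        using K_sub \<tau>.hom_one by (simp add: N'_def subgroup.one_closed)
      fix g assume g: "g \<in> N'"
      then have gK: "g \<in> K" and g_car: "g \<in> carrier F" using K_car by (auto simp: N'_def)
      have "\<tau> (?conj f (inv\<^bsub>F\<^esub> g)) = inv\<^bsub>?E\<^esub> \<tau> (?conj f g)" if "f \<in> carrier F" for f
      proof -
        have "?conj f (inv\<^bsub>F\<^esub> g) = inv\<^bsub>F\<^esub> ?conj f g"
          using that g_car by (simp add: F.inv_mult_group F.m_assoc)
        then show ?thesis
          using \<tau>.hom_inv[of "?conj f g"] conjH[OF that gK] H by simp
      qed
      then show "inv\<^bsub>F\<^esub> g \<in> N'"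
        using g K_sub by (simp add: N'_def subgroup.m_inv_closed)
      fix g' assume g': "g' \<in> N'"
      then have gK': "g' \<in> K" and g_car': "g' \<in> carrier F" using K_car by (auto simp: N'_def)
      have "\<tau> (?conj f (g \<otimes>\<^bsub>F\<^esub> g')) = \<tau> (?conj f g) \<otimes>\<^bsub>?E\<^esub> \<tau> (?conj f g')"
        if "f \<in> carrier F" for f
      proof -
        have "inv\<^bsub>F\<^esub> f \<otimes>\<^bsub>F\<^esub> (f \<otimes>\<^bsub>F\<^esub> z) = z" if "z \<in> carrier F" for z
          using that \<open>f \<in> carrier F\<close> by (simp flip: F.m_assoc)
        then have "?conj f (g \<otimes>\<^bsub>F\<^esub> g') = ?conj f g \<otimes>\<^bsub>F\<^esub> ?conj f g'"
          using that g_car g_car' by (simp add: F.m_assoc)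
        then show ?thesis
          using \<tau>.hom_mult[of "?conj f g" "?conj f g'"] conjH[OF that gK] conjH[OF that gK'] by simp
      qed
      then show "g \<otimes>\<^bsub>F\<^esub> g' \<in> N'"
        using g g' K_sub by (simp add: N'_def subgroup.m_closed)
    qed
    show "?conj x g \<in> N'" if "x \<in> carrier F" "g \<in> N'" for x g
      using that conjK K_car by (auto simp: N'_def subset_iff simp flip: conj_mult)
  qed
  have S_N': "?S \<subseteq> N'"
  proof
    fix s assume s: "s \<in> ?S"
    have sK: "s \<in> K" using s SK by blast
    have "\<tau> (?conj t s) \<in> lp_kernel L" if t: "t \<in> T" for t
      using s
    proof
      assume "s \<in> Q"
      then have "\<tau> (?conj t s) \<in> fixed_rels L" using t by (auto simp: L_def)
      then show ?thesis using R_kern by blast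
    next
      assume "s \<in> (\<Union>\<sigma>\<in>lists W. word_act \<sigma> ` P)"
      then obtain \<sigma> p where \<sigma>: "\<sigma> \<in> lists W" and p: "p \<in> P" and s_eq: "s = word_act \<sigma> p"
        by blast
      interpret \<sigma>: group_hom F F "word_act \<sigma>" by unfold_locales (rule word_hom[OF \<sigma>])
      have car: "t \<in> carrier F" "p \<in> carrier F" using t T(2) p P(2) by auto
      have "\<tau> (word_act \<sigma> (?conj t p)) \<in> lp_kernel L" using R_iter[OF \<sigma> t p] R_kern by blast
      \<comment> \<open>\<open>\<sigma>\<close> moves the conjugating element \<open>t\<close> too,
        but only inside its coset, so \<open>kern_coset\<close> can restore
        \<open>t\<close>.\<close>
      then have "\<tau> (?conj (word_act \<sigma> t) s) \<in> lp_kernel L" using car by (simp add: s_eq)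
      then show ?thesis
        using kern_coset[OF sK _ car(1) word_coset[OF \<sigma> car(1)]] car(1) by simp
    qed
    then have "\<tau> (?conj f s) \<in> lp_kernel L" if "f \<in> carrier F" for f
      using T_cover[OF that] kern_coset[OF sK _ that] T(2) by (metis subset_iff)
    then show "s \<in> N'" using sK by (simp add: N'_def)
  qed
  have K_kern: "\<tau> k \<in> lp_kernel L" if "k \<in> K" for k
  proof -
    have "k \<in> N'"
      using normal_closure_minimal[OF N'_normal S_N'] that K_eq by blast
    \<comment> \<open>The instance of the condition in \<open>N'\<close> where \<open>f\<close> is
      the identity.\<close>
    then show ?thesis
      using that KH H_sub by (auto simp: N'_def dest!: bspec[of _ _ "\<one>\<^bsub>F\<^esub>"])
  qed
  have kernel: "lp_kernel L = N"
  proof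
    show "lp_kernel L \<subseteq> N"
      unfolding lp_kernel_def using R_N N_normal by (simp add: normal_closure_minimal)
    show "N \<subseteq> lp_kernel L"
    proof
      fix e assume "e \<in> N"
      then have e: "e \<in> carrier ?E" and "\<tau> (\<pi> e) \<in> lp_kernel L" by (auto simp: N_def K_kern)
      \<comment> \<open>\<open>e\<close> and \<open>\<tau> (\<pi> e)\<close> have the same coset of
        \<open>lp_kernel L\<close>, and the latter lies in \<open>lp_kernel L\<close>.\<close>
      then have "lp_kernel L #>\<^bsub>?E\<^esub> e = lp_kernel L"
        using \<tau>\<pi>_mod[OF e] E.coset_join2[OF _ kern.subgroup_axioms] kern.mem_carrier by metis
      then show "e \<in> lp_kernel L"
        using E.coset_join1[OF _ e kern.subgroup_axioms] kern.subset by metis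
    qed
  qed
  have "invariant_lpres L"
    unfolding invariant_lpres_def kernel
  proof (intro ballI subsetI)
    fix \<phi> e assume "\<phi> \<in> endos L" "e \<in> \<phi> ` N"
    then obtain w d where w: "w \<in> W" and d: "d \<in> carrier ?E" "\<pi> d \<in> K" and e: "e = \<tau> (w (\<pi> d))"
      by (auto simp: L_def lift_def N_def)
    then have "w (\<pi> d) \<in> K" using WK by blast
    \<comment> \<open>\<open>w (\<pi> d)\<close> lies in \<open>H\<close>, so \<open>\<pi>\<close>
      recovers it from \<open>e\<close>.\<close>
    then show "e \<in> N" using e KH \<tau>_in \<pi>\<tau> by (auto simp: N_def)
  qed
  then show thesis
  proof (rule that[OF fin])
    show "\<pi> \<in> hom (free_of L) (F\<lparr>carrier := H\<rparr>)" using \<pi> by simp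
    show "lp_kernel L = {e \<in> carrier (free_of L). \<pi> e \<in> K}" unfolding kernel N_def free_L ..
    show "\<pi> ` carrier (free_of L) = H"
    proof
      show "H \<subseteq> \<pi> ` carrier (free_of L)"
        using \<pi>\<tau>[symmetric] \<tau>_in by (intro subsetI image_eqI) auto
    qed (use \<pi>_in in auto)
  qed
qed

section \<open>Leaf-invariant subgroups\<close>

text \<open>Each comparison of words of equal length is decided at one position, to the right of
  which the letters agree. If the two deciding positions differ, the right one carries equal letters
  that are related; if they coincide, transitivity relates a letter to itself.\<close>

lemma word_less_asym:
  assumes "trans r" "irrefl r" "word_less r \<sigma> \<delta>"
  shows "\<not> word_less r \<delta> \<sigma>"
proof
  assume less: "word_less r \<delta> \<sigma>"
  have len: "length \<sigma> = length \<delta>" using assms(3) less by (auto simp: word_less_def)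
  obtain k where k: "k < length \<sigma>" "(\<sigma> ! k, \<delta> ! k) \<in> r"
      "\<And>i. k < i \<Longrightarrow> i < length \<sigma> \<Longrightarrow> \<sigma> ! i = \<delta> ! i"
    using assms(3) len by (auto simp: word_less_def)
  obtain l where l: "l < length \<delta>" "(\<delta> ! l, \<sigma> ! l) \<in> r"
      "\<And>i. l < i \<Longrightarrow> i < length \<delta> \<Longrightarrow> \<delta> ! i = \<sigma> ! i"
    using less len by (auto simp: word_less_def)
  consider "k < l" | "l < k" | "k = l" by linarith
  then have "\<exists>x. (x, x) \<in> r"
  proof cases
    case 1
    then show ?thesis using k(3)[of l] l len by metis
  next
    case 2
    then show ?thesis using l(3)[of k] k len by metis
  next
    case 3
    then show ?thesis using k(2) l(2) \<open>trans r\<close> by (blast dest: transD)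
  qed
  then show False using \<open>irrefl r\<close> by (auto simp: irrefl_def)
qed

section \<open>Coset permutations and the finiteness of the set of least words\<close>

lemma coset_perm_mult:
  assumes "group F" "subgroup H F" "g \<in> carrier F" "h \<in> carrier F"
  shows "coset_perm F H (g \<otimes>\<^bsub>F\<^esub> h) =
    (\<lambda>C\<in>rcosets\<^bsub>F\<^esub> H. coset_perm F H h (coset_perm F H g C))"
proof -
  interpret group F by fact
  have "C #>\<^bsub>F\<^esub> (g \<otimes>\<^bsub>F\<^esub> h) = C #>\<^bsub>F\<^esub> g #>\<^bsub>F\<^esub> h \<and> C #>\<^bsub>F\<^esub> g \<in> rcosets\<^bsub>F\<^esub> H"
    if "C \<in> rcosets\<^bsub>F\<^esub> H" for C
    using that assms subgroup.subset[OF assms(2)] by (auto simp: RCOSETS_def coset_mult_assoc m_assoc)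
  then show ?thesis
    using assms by (auto simp: coset_perm_def intro!: restrict_ext)
qed

text \<open>Both sides multiply along words by \<open>coset_perm_mult\<close>, so an induced
  homomorphism is determined by its values on letters.\<close>

lemma word_perm_eqI:
  assumes fin: "finite_lpres L" and H: "subgroup (full_preimage L U) (free_of L)"
    and words: "\<sigma> \<in> lists (endos L)" "\<delta> \<in> lists (endos L)"
    and letters: "\<And>a. fst a \<in> gens L \<Longrightarrow> word_perm L U \<sigma> [a] = word_perm L U \<delta> [a]"
  shows "word_perm L U \<sigma> = word_perm L U \<delta>"
proof -
  interpret F: group "free_of L" by (rule free_group_group)
  have endos: "endos L \<subseteq> hom (free_of L) (free_of L)" using fin by (auto simp: finite_lpres_def)
  interpret \<sigma>: group_hom "free_of L" "free_of L" "word_act \<sigma>"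
    using words(1) endos by unfold_locales (intro word_act_hom, auto)
  interpret \<delta>: group_hom "free_of L" "free_of L" "word_act \<delta>"
    using words(2) endos by unfold_locales (intro word_act_hom, auto)
  have "coset_perm (free_of L) (full_preimage L U) (word_act \<sigma> w)
      = coset_perm (free_of L) (full_preimage L U) (word_act \<delta> w)"
    if "w \<in> carrier (free_of L)" for w
    using that
  proof (induction rule: free_group_induct)
    case one
    then show ?case using \<sigma>.hom_one \<delta>.hom_one by (simp add: one_free_group)
  next
    case (letter a w)
    then have a: "[a] \<in> carrier (free_of L)" by (simp add: letter_in_free_group)
    then show ?case
      using letters[OF letter.hyps(1)] letter.IH letter.hyps(2)
      by (simp add: letter.hyps(3) coset_perm_mult[OF F.is_group H] word_perm_def)
  qed
  then show ?thesis by (auto simp: word_perm_def intro!: restrict_ext)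
qed

text \<open>A least word is determined by the homomorphism it induces, and that by the maps which
  finitely many letters induce on finitely many cosets.\<close>

lemma finite_least_words:
  assumes fin: "finite_lpres L" and H: "subgroup (full_preimage L U) (free_of L)"
    and finH: "finite (rcosets\<^bsub>free_of L\<^esub> (full_preimage L U))"
    and r: "strict_linear_order_on (endos L) r"
  shows "finite (least_words L r U)"
proof -
  let ?C = "rcosets\<^bsub>free_of L\<^esub> (full_preimage L U)" and ?A = "gens L \<times> (UNIV :: bool set)"
  define p where "p \<sigma> = (\<lambda>a\<in>?A. word_perm L U \<sigma> [a])" for \<sigma>
  have "inj_on p (least_words L r U)"
  proof (rule inj_onI)
    fix \<sigma> \<delta> assume \<sigma>: "\<sigma> \<in> least_words L r U" and \<delta>: "\<delta> \<in> least_words L r U" and eq: "p \<sigma> = p \<delta>"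
    have words: "\<sigma> \<in> lists (endos L)" "\<delta> \<in> lists (endos L)"
      using \<sigma> \<delta> by (auto simp: least_words_def)
    have "word_perm L U \<sigma> [a] = word_perm L U \<delta> [a]" if "fst a \<in> gens L" for a
      using fun_cong[OF eq, of a] that by (cases a) (simp add: p_def)
    then have "word_perm L U \<sigma> = word_perm L U \<delta>"
      by (rule word_perm_eqI[OF fin H words])
    \<comment> \<open>Distinct least words for the same homomorphism would each precede the
      other.\<close>
    then have "\<sigma> = \<delta> \<or> word_less r \<sigma> \<delta> \<and> word_less r \<delta> \<sigma>"
      using \<sigma> \<delta> words unfolding least_words_def by (metis (mono_tags, lifting) mem_Collect_eq)
    then show "\<sigma> = \<delta>"
      using r word_less_asym by (auto simp: strict_linear_order_on_def)
  qed
  moreover have "p ` least_words L r U \<subseteq> ?A \<rightarrow>\<^sub>E (?C \<rightarrow>\<^sub>E ?C)"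
  proof (rule image_subsetI, rule PiE_I)
    fix \<sigma> a assume \<sigma>: "\<sigma> \<in> least_words L r U" and a: "a \<in> ?A"
    have "word_act \<sigma> \<in> hom (free_of L) (free_of L)"
      using \<sigma> fin by (intro word_act_hom) (auto simp: least_words_def finite_lpres_def)
    moreover have "[a] \<in> carrier (free_of L)" using a by (auto simp: letter_in_free_group)
    ultimately have "p \<sigma> a \<in> carrier (BijGroup ?C)"
      using a by (auto simp: p_def word_perm_def hom_in_carrier
        intro!: coset_perm_BijGroup free_group_group H)
    then show "p \<sigma> a \<in> ?C \<rightarrow>\<^sub>E ?C"
      by (auto simp: BijGroup_def Bij_def bij_betw_def PiE_def)
  qed (auto simp: p_def)
  moreover have "finite (?A \<rightarrow>\<^sub>E (?C \<rightarrow>\<^sub>E ?C))"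
    using fin finH by (intro finite_PiE) (auto simp: finite_lpres_def)
  ultimately show ?thesis
    using finite_subset finite_imageD by metis
qed

text \<open>For a word outside \<open>V\<close>, stripping letters from the left until the tail lies
  in \<open>V\<close> exposes a leaf as a suffix, at the latest when the tail is \<open>[]\<close>.
  The prefix before it is shorter and is factored in the same way.\<close>

lemma leaf_factorization:
  assumes "[] \<in> V" and "\<sigma> \<in> lists \<Phi>"
  shows "\<exists>v\<in>V. \<exists>\<sigma>s\<in>lists {\<psi> # \<delta> | \<psi> \<delta>. \<psi> \<in> \<Phi> \<and> \<delta> \<in> V \<and> \<psi> # \<delta> \<notin> V}. \<sigma> = v @ concat \<sigma>s"
  using assms(2)
proof (induction \<sigma> rule: length_induct)
  case (1 \<sigma>)
  let ?\<Psi> = "{\<psi> # \<delta> | \<psi> \<delta>. \<psi> \<in> \<Phi> \<and> \<delta> \<in> V \<and> \<psi> # \<delta> \<notin> V}"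
  show ?case
  proof (cases "\<sigma> \<in> V")
    case True
    then show ?thesis by (intro bexI[of _ \<sigma>] bexI[of _ "[]"]) auto
  next
    case False
    have "\<exists>\<rho> \<omega>. \<sigma> = \<rho> @ \<omega> \<and> \<omega> \<in> ?\<Psi>"
      using False 1(2)
    proof (induction \<sigma>)
      case (Cons \<phi> \<sigma>)
      show ?case
      proof (cases "\<sigma> \<in> V")
        case True
        then show ?thesis using Cons.prems by - (rule exI[of _ "[]"], rule exI[of _ "\<phi> # \<sigma>"], auto)
      next
        case False
        then obtain \<rho> \<omega> where "\<sigma> = \<rho> @ \<omega>" "\<omega> \<in> ?\<Psi>"
          using Cons.IH Cons.prems(2) by auto
        then have "\<phi> # \<sigma> = (\<phi> # \<rho>) @ \<omega> \<and> \<omega> \<in> ?\<Psi>" by simp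
        then show ?thesis by (intro exI)
      qed
    qed (use assms(1) in simp)
    then obtain \<rho> \<omega> where \<omega>: "\<sigma> = \<rho> @ \<omega>" "\<omega> \<in> ?\<Psi>" by blast
    then have "length \<rho> < length \<sigma>" "\<rho> \<in> lists \<Phi>" using 1(2) by auto
    then obtain v \<sigma>s where v: "v \<in> V" "\<sigma>s \<in> lists ?\<Psi>" "\<rho> = v @ concat \<sigma>s"
      using 1(1) by blast
    show ?thesis
      using v \<omega> by (intro bexI[of _ v] bexI[of _ "\<sigma>s @ [\<omega>]"]) (simp_all add: append_in_lists_conv)
  qed
qed

text \<open>\<open>finite_index_lpres\<close> is applied with the endomorphisms induced by leaves as
  \<open>W\<close>. Leaf-invariance supplies its coset condition, and invariance of \<open>L\<close>
  shows that \<open>W\<close> preserves the kernel.\<close>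

theorem theorem7p1:
  fixes L :: "'a lpres"
    and prec :: "('a endo \<times> 'a endo) set"
    and U :: "'a letter list set set"
  assumes "finite_lpres L"
    and "invariant_lpres L"
    and "strict_linear_order_on (endos L) prec"
    and "subgroup U (lp_group L)"
    and "finite (rcosets\<^bsub>lp_group L\<^esub> U)"
    and "leaf_invariant L prec U"
  shows "invariantly_finitely_L_presented ((lp_group L)\<lparr>carrier := U\<rparr>)"
proof -
  let ?F = "free_of L" and ?K = "lp_kernel L" and ?V = "least_words L prec U"
  let ?G = "(lp_group L)\<lparr>carrier := U\<rparr>"
  define H where "H = full_preimage L U"
  interpret F: group ?F by (rule free_group_group)
  have fin: "finite (gens L)" "finite (fixed_rels L)" "fixed_rels L \<subseteq> carrier ?F"
    "finite (iter_rels L)" "iter_rels L \<subseteq> carrier ?F" "finite (endos L)"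
    "endos L \<subseteq> hom ?F ?F"
    using assms(1) by (auto simp: finite_lpres_def)
  have word_hom: "word_act \<sigma> \<in> hom ?F ?F" if "\<sigma> \<in> lists (endos L)" for \<sigma>
    using that fin(7) by (intro word_act_hom) auto
  let ?S = "fixed_rels L \<union> (\<Union>\<sigma>\<in>lists (endos L). word_act \<sigma> ` iter_rels L)"
  have "?S \<subseteq> carrier ?F"
    using fin(3,5) by (auto simp del: in_lists_conv_set intro!: hom_in_carrier[OF word_hom])
  then have K_normal: "?K \<lhd> ?F"
    unfolding lp_kernel_def by (rule normal_closure_normal[OF F.is_group])
  interpret K: normal ?K ?F by (rule K_normal)
  interpret G: group "lp_group L" unfolding lp_group_def by (rule K.factorgroup_is_group)
  have proj: "(\<lambda>g. ?K #>\<^bsub>?F\<^esub> g) \<in> hom ?F (lp_group L)"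
    unfolding lp_group_def by (rule K.r_coset_hom_Mod)
  interpret proj: group_hom ?F "lp_group L" "\<lambda>g. ?K #>\<^bsub>?F\<^esub> g" by unfold_locales (rule proj)
  have H: "subgroup H ?F"
    using assms(4) by unfold_locales
      (auto simp: H_def full_preimage_def proj.hom_mult proj.hom_one proj.hom_inv
        subgroup.m_closed subgroup.one_closed subgroup.m_inv_closed simp del: F.coset_mult_one)
  have one_G: "\<one>\<^bsub>lp_group L\<^esub> = ?K" by (simp add: lp_group_def)
  have K_coset: "?K #>\<^bsub>?F\<^esub> g = ?K \<longleftrightarrow> g \<in> ?K" if "g \<in> carrier ?F" for g
    using that F.coset_join1[OF _ that K.subgroup_axioms] F.coset_join2[OF that K.subgroup_axioms]
    by blast
  have K_H: "?K \<subseteq> H"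
  proof
    fix k assume k: "k \<in> ?K"
    have "?K #>\<^bsub>?F\<^esub> k = ?K" using k by (simp only: K_coset[OF K.mem_carrier])
    moreover have "?K \<in> U" using subgroup.one_closed[OF assms(4)] by (simp add: one_G)
    ultimately show "k \<in> H" using k K.mem_carrier by (simp add: H_def full_preimage_def)
  qed
  \<comment> \<open>Elements of the free group whose images lie in the same coset of
    \<open>U\<close> lie in the same coset of \<open>H\<close>, so finitely many representatives
    suffice.\<close>
  have finH: "finite (rcosets\<^bsub>?F\<^esub> H)"
  proof -
    let ?q = "\<lambda>g. U #>\<^bsub>lp_group L\<^esub> (?K #>\<^bsub>?F\<^esub> g)"
    have "?q ` carrier ?F \<subseteq> rcosets\<^bsub>lp_group L\<^esub> U"
      using subgroup.subset[OF assms(4)] by (intro image_subsetI G.rcosetsI proj.hom_closed)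
    then have "finite (?q ` carrier ?F)" using assms(5) by (rule finite_subset)
    from finite_subset_image[OF this subset_refl] obtain T where T: "T \<subseteq> carrier ?F" "finite T" "?q ` carrier ?F = ?q ` T"
      by auto
    have "rcosets\<^bsub>?F\<^esub> H \<subseteq> (\<lambda>t. H #>\<^bsub>?F\<^esub> t) ` T"
    proof
      fix C assume "C \<in> rcosets\<^bsub>?F\<^esub> H"
      then obtain g where g: "g \<in> carrier ?F" "C = H #>\<^bsub>?F\<^esub> g" by (auto simp: RCOSETS_def)
      then obtain t where t: "t \<in> T" "?q g = ?q t" using T(3) by blast
      have t_car: "t \<in> carrier ?F" using t T by blast
      have "g \<otimes>\<^bsub>?F\<^esub> inv\<^bsub>?F\<^esub> t \<in> H"
        using G.rcoset_eq_iff[OF assms(4) proj.hom_closed[OF g(1)] proj.hom_closed[OF t_car]]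
          t(2) g(1) t_car
        by (simp add: H_def full_preimage_def proj.hom_mult proj.hom_inv)
      then show "C \<in> (\<lambda>t. H #>\<^bsub>?F\<^esub> t) ` T"
        using F.rcoset_eq_iff[OF H g(1) t_car] g(2) t(1) by blast
    qed
    then show ?thesis using T(2) finite_subset by blast
  qed
  have finV: "finite ?V"
    using finite_least_words[OF assms(1) _ _ assms(3)] H finH by (simp add: H_def)
  have V_words: "?V \<subseteq> lists (endos L)" by (auto simp: least_words_def)
  \<comment> \<open>The empty word is shorter than every other word.\<close>
  have Nil_V: "[] \<in> ?V"
    by (auto simp: least_words_def word_less_def)
  let ?\<Psi> = "{\<psi> # \<delta> | \<psi> \<delta>. \<psi> \<in> endos L \<and> \<delta> \<in> ?V \<and> \<psi> # \<delta> \<notin> ?V}"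
  have \<Psi>_words: "?\<Psi> \<subseteq> lists (endos L)" using V_words by (auto simp: subset_iff in_lists_conv_set)
  have "?\<Psi> \<subseteq> (\<lambda>(\<psi>, \<delta>). \<psi> # \<delta>) ` (endos L \<times> ?V)" by auto
  then have fin\<Psi>: "finite ?\<Psi>" by (rule finite_subset) (simp add: finV fin(6))
  define W where "W = word_act ` ?\<Psi>"
  \<comment> \<open>The least word at the front of a factorization acts first, so it is absorbed
    into the relators; finiteness of the set of least words keeps \<open>P\<close> finite.\<close>
  define P where "P = (\<Union>v\<in>?V. word_act v ` iter_rels L)"
  have W_coset: "H #>\<^bsub>?F\<^esub> w g = H #>\<^bsub>?F\<^esub> g" if w: "w \<in> W" and g: "g \<in> carrier ?F" for w g
  proof -
    obtain \<omega> where \<omega>: "\<omega> \<in> ?\<Psi>" "w = word_act \<omega>" using w by (auto simp: W_def)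
    then have "word_perm L U \<omega> = word_perm L U []"
      using assms(6) by (auto simp: leaf_invariant_def)
    from fun_cong[OF this, of g] have "coset_perm ?F H (w g) = coset_perm ?F H g"
      using g by (simp add: word_perm_def \<omega>(2) H_def)
    \<comment> \<open>Leaf-invariance equates whole permutations; their values at the coset
      \<open>H\<close> are the two cosets to be compared.\<close>
    from fun_cong[OF this, of H]
    have "coset_perm ?F H (w g) H = coset_perm ?F H g H" .
    moreover have "w g \<in> carrier ?F"
      unfolding \<omega>(2) using \<omega>(1) \<Psi>_words g by (intro hom_in_carrier[OF word_hom]) blast+
    moreover have "H \<in> rcosets\<^bsub>?F\<^esub> H"
      using F.rcosetsI[OF subgroup.subset[OF H] F.one_closed] subgroup.subset[OF H] by simp
    ultimately show ?thesis
      using g by (simp add: coset_perm_def)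
  qed
  have words_eq: "(\<Union>\<sigma>\<in>lists (endos L). word_act \<sigma> ` iter_rels L) = (\<Union>\<sigma>\<in>lists W. word_act \<sigma> ` P)"
    (is "?A = ?B")
  proof
    show "?A \<subseteq> ?B"
    proof
      fix x assume "x \<in> ?A"
      then obtain \<sigma> r where \<sigma>: "\<sigma> \<in> lists (endos L)" "r \<in> iter_rels L" "x = word_act \<sigma> r" by blast
      obtain v \<sigma>s where v: "v \<in> ?V" "\<sigma>s \<in> lists ?\<Psi>" "\<sigma> = v @ concat \<sigma>s"
        using leaf_factorization[OF Nil_V \<sigma>(1)] by blast
      have "map word_act \<sigma>s \<in> lists W" using v(2) by (auto simp: W_def)
      moreover have "word_act v r \<in> P" using v(1) \<sigma>(2) by (auto simp: P_def)
      ultimately show "x \<in> ?B" using \<sigma>(3) v(3) by (auto simp: word_act_concat)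
    qed
    show "?B \<subseteq> ?A"
    proof
      fix x assume "x \<in> ?B"
      then obtain \<sigma> v r where \<sigma>: "\<sigma> \<in> lists W" "v \<in> ?V" "r \<in> iter_rels L"
          "x = word_act \<sigma> (word_act v r)"
        by (auto simp: P_def simp del: in_lists_conv_set)
      then obtain \<sigma>s where \<sigma>s: "\<sigma>s \<in> lists ?\<Psi>" "\<sigma> = map word_act \<sigma>s"
        by (auto simp: W_def lists_image simp del: in_lists_conv_set)
      have "\<sigma>s \<in> lists (lists (endos L))"
        by (rule subsetD[OF lists_mono[OF \<Psi>_words] \<sigma>s(1)])
      then have "v @ concat \<sigma>s \<in> lists (endos L)"
        using subsetD[OF V_words \<sigma>(2)] by (auto simp: in_lists_conv_set)
      moreover have "x = word_act (v @ concat \<sigma>s) r"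
        using \<sigma>(4) \<sigma>s(2) by (simp add: word_act_concat)
      ultimately show "x \<in> ?A" using \<sigma>(3) by blast
    qed
  qed
  have W_hom: "W \<subseteq> hom ?F ?F"
    unfolding W_def by (intro image_subsetI word_hom subsetD[OF \<Psi>_words])
  have W_K: "w ` ?K \<subseteq> ?K" if w: "w \<in> W" for w
  proof -
    obtain \<omega> where \<omega>: "\<omega> \<in> ?\<Psi>" "w = word_act \<omega>" using w unfolding W_def by (rule imageE)
    have "\<phi> ` ?K \<subseteq> ?K" if "\<phi> \<in> endos L" for \<phi>
      using assms(2) that by (simp add: invariant_lpres_def)
    then show ?thesis
      unfolding \<omega>(2) by (rule word_act_invariant[OF _ subsetD[OF \<Psi>_words \<omega>(1)]])
  qed
  have P_car: "P \<subseteq> carrier ?F"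
    unfolding P_def
    by (intro UN_least image_subsetI hom_in_carrier[OF word_hom]
        subsetD[OF V_words] subsetD[OF fin(5)])
  have finW: "finite W" using fin\<Psi> by (simp add: W_def)
  have finP: "finite P" using finV fin(4) by (simp add: P_def)
  have K_eq: "?K = normal_closure ?F (fixed_rels L \<union> (\<Union>\<sigma>\<in>lists W. word_act \<sigma> ` P))"
    by (simp only: lp_kernel_def words_eq)
  obtain L' :: "nat lpres" and \<pi> where L': "finite_lpres L'" "invariant_lpres L'"
    and \<pi>: "\<pi> \<in> hom (free_of L') (?F\<lparr>carrier := H\<rparr>)" "\<pi> ` carrier (free_of L') = H"
    and kernel: "lp_kernel L' = {e \<in> carrier (free_of L'). \<pi> e \<in> ?K}"
  proof (rule finite_index_lpres[OF fin(1) H finH finW W_hom _ fin(2,3) finP P_car K_eq K_H])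
    show "H #>\<^bsub>?F\<^esub> w g = H #>\<^bsub>?F\<^esub> g" if "w \<in> W" "g \<in> carrier ?F" for w g
      using that by (rule W_coset)
    show "w ` ?K \<subseteq> ?K" if "w \<in> W" for w
      using that by (rule W_K)
  qed
  \<comment> \<open>\<open>\<pi>\<close> followed by the projection maps onto \<open>U\<close>,
    because \<open>H\<close> is the full preimage, and has kernel \<open>lp_kernel L'\<close>. The
    first isomorphism theorem then applies.\<close>
  let ?\<theta> = "\<lambda>e. ?K #>\<^bsub>?F\<^esub> \<pi> e"
  have \<pi>_H: "\<pi> e \<in> H" if "e \<in> carrier (free_of L')" for e using \<pi>(2) that by blast
  have H_F: "H \<subseteq> carrier ?F" using H by (rule subgroup.subset)
  interpret \<theta>: group_hom "free_of L'" ?G ?\<theta>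
  proof (intro group_hom.intro group_hom_axioms.intro)
    show "group (free_of L')" by (rule free_group_group)
    show "group ?G" using assms(4) by (rule G.subgroup_imp_group)
    show "?\<theta> \<in> hom (free_of L') ?G"
      using \<pi>_H H_F hom_mult[OF \<pi>(1)]
      by (intro homI) (auto simp: H_def full_preimage_def subset_iff proj.hom_mult)
  qed
  have "?\<theta> ` carrier (free_of L') = U"
  proof -
    have "?\<theta> ` carrier (free_of L') = (\<lambda>g. ?K #>\<^bsub>?F\<^esub> g) ` H"
      using \<pi>(2) by (auto simp: image_iff)
    also have "\<dots> = U"
      using subgroup.subset[OF assms(4)]
      by (force simp: H_def full_preimage_def lp_group_def FactGroup_def RCOSETS_def)
    finally show ?thesis .
  qed
  moreover have ker: "kernel (free_of L') ?G ?\<theta> = lp_kernel L'"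
    using K_coset \<pi>_H H_F by (auto simp: kernel_def kernel one_G)
  ultimately have "lp_group L' \<cong> ?G"
    using \<theta>.FactGroup_iso by (simp add: lp_group_def)
  moreover have "group (lp_group L')"
    using \<theta>.normal_kernel ker normal.factorgroup_is_group
    by (simp add: lp_group_def[of L'])
  ultimately have "?G \<cong> lp_group L'" by (simp add: group.iso_sym)
  then show ?thesis
    using L' unfolding invariantly_finitely_L_presented_def by blast
qed

end
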